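(* Let $(X,T)$ be a dynamical system that is distal and null. Then $(X,T)$ is equicontinuous.
   Context: A dynamical system $(X,T)$ is a compact metric space $(X,d)$ with a continuous map $T:X\to X$. A pair $(x,y)$ is proximal if $\inf_{n\ge1}d(T^nx,T^ny)=0$; $(X,T)$ is distal if the only proximal pairs are $(x,x)$. $(X,T)$ is equicontinuous if $\{T^n:n\ge0\}$ is an equicontinuous family. For an increasing sequence $A=\{0\le t_1<t_2<\cdots\}\subseteq\mathbb{Z}_+$ and a finite open cover $\mathcal U$, $h^A_{top}(T,\mathcal U)=\limsup_{n\to\infty}\frac1n\log N(\bigvee_{i=1}^nT^{-t_i}\mathcal U)$, where $N(\cdot)$ is the minimal cardinality of a subcover, and $h^A_{top}(T)=\sup_{\mathcal U}h^A_{top}(T,\mathcal U)$. $(X,T)$ is null if $h^A_{top}(T)=0$ for every increasing sequence $A$. *)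

theory Defs
  imports "HOL-Analysis.Analysis" "HOL-Library.Liminf_Limsup"
begin

definition dyn_system :: "'a::metric_space set \<Rightarrow> ('a \<Rightarrow> 'a) \<Rightarrow> bool" where
  "dyn_system X T \<longleftrightarrow> compact X \<and> continuous_on X T \<and> T ` X \<subseteq> X"

definition proximal :: "'a::metric_space set \<Rightarrow> ('a \<Rightarrow> 'a) \<Rightarrow> 'a \<Rightarrow> 'a \<Rightarrow> bool" where
  "proximal X T x y \<longleftrightarrow> (INF n\<in>{1::nat..}. dist ((T^^n) x) ((T^^n) y)) = 0"

definition distal :: "'a::metric_space set \<Rightarrow> ('a \<Rightarrow> 'a) \<Rightarrow> bool" where
  "distal X T \<longleftrightarrow> (\<forall>x\<in>X. \<forall>y\<in>X. proximal X T x y \<longrightarrow> x = y)"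

definition equicontinuous_sys :: "'a::metric_space set \<Rightarrow> ('a \<Rightarrow> 'a) \<Rightarrow> bool" where
  "equicontinuous_sys X T \<longleftrightarrow>
     (\<forall>x\<in>X. \<forall>e>0. \<exists>d>0. \<forall>y\<in>X. dist x y < d \<longrightarrow> (\<forall>n. dist ((T^^n) x) ((T^^n) y) < e))"

definition finite_open_cover :: "'a::metric_space set \<Rightarrow> 'a set set \<Rightarrow> bool" where
  "finite_open_cover X U \<longleftrightarrow> finite U \<and> (\<forall>V\<in>U. openin (top_of_set X) V) \<and> X \<subseteq> \<Union>U"

definition cover_num :: "'a set \<Rightarrow> 'a set set \<Rightarrow> nat" where
  "cover_num X U = (LEAST k. \<exists>W\<subseteq>U. finite W \<and> card W = k \<and> X \<subseteq> \<Union>W)"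

text \<open>The join of T^{-t_1} U, ..., T^{-t_n} U (sequence indexed from 0: t 0 = t_1).\<close>
definition join_cover :: "'a set \<Rightarrow> ('a \<Rightarrow> 'a) \<Rightarrow> (nat \<Rightarrow> nat) \<Rightarrow> 'a set set \<Rightarrow> nat \<Rightarrow> 'a set set" where
  "join_cover X T t U n =
     {X \<inter> (\<Inter>i<n. (T^^(t i)) -` (f i)) | f. \<forall>i<n. f i \<in> U}"

definition seq_entropy_cover :: "'a set \<Rightarrow> ('a \<Rightarrow> 'a) \<Rightarrow> (nat \<Rightarrow> nat) \<Rightarrow> 'a set set \<Rightarrow> ereal" where
  "seq_entropy_cover X T t U =
     limsup (\<lambda>n. ereal (ln (real (cover_num X (join_cover X T t U n))) / real n))"

definition seq_entropy :: "'a::metric_space set \<Rightarrow> ('a \<Rightarrow> 'a) \<Rightarrow> (nat \<Rightarrow> nat) \<Rightarrow> ereal" where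
  "seq_entropy X T t = (SUP U\<in>{U. finite_open_cover X U}. seq_entropy_cover X T t U)"

definition null_sys :: "'a::metric_space set \<Rightarrow> ('a \<Rightarrow> 'a) \<Rightarrow> bool" where
  "null_sys X T \<longleftrightarrow> (\<forall>t. strict_mono t \<longrightarrow> seq_entropy X T t = 0)"

end

theory Submission
  imports Defs
begin

text \<open>
  In a distal system every idempotent of the enveloping semigroup is the identity, so every
  element \<open>p\<close> of that semigroup has a left inverse \<open>q\<close> in it. If equicontinuity fails at \<open>x0\<close>,
  there are \<open>y k \<longlonglongrightarrow> x0\<close> and times \<open>n k\<close> such that (along a common subnet) \<open>T ^^ n k\<close> tends
  pointwise to some \<open>p\<close> while \<open>(T ^^ n k) (y k)\<close> tends to some \<open>z \<noteq> p x0\<close>. Following these times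
  by ones approximating \<open>q\<close> gives a point \<open>z0 = q z \<noteq> x0\<close> and times \<open>n\<close> for which \<open>T ^^ n\<close> almost
  fixes any prescribed finite set of points and yet moves some point near \<open>x0\<close> to a point near \<open>z0\<close>.
  Applying this repeatedly, adding each new point to the finite set, yields points \<open>x i\<close> and times
  \<open>n i\<close> such that \<open>T ^^ (\<Sum>i\<in>J. n i)\<close> sends \<open>x i\<close> near \<open>z0\<close> for \<open>i \<in> J\<close> and near \<open>x0\<close> for
  \<open>i \<notin> J\<close>. Choosing the sets \<open>J\<close> suitably, neighbourhoods of \<open>x0\<close> and \<open>z0\<close> have arbitrarily large
  finite independent sets of times; concatenating such sets of rapidly growing size produces
  positive sequence entropy.
\<close>

section \<open>Idempotents in compact semigroups of maps\<close>

lemma compact_fun_imp_closed: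
  fixes S :: "('i \<Rightarrow> 'a::metric_space) set"
  assumes "compact S"
  shows "closed S"
proof -
  have "Hausdorff_space (euclidean :: ('i \<Rightarrow> 'a) topology)"
    by (simp add: Hausdorff_space_product_topology flip: euclidean_product_topology)
  then show ?thesis
    using assms by (metis closed_closedin compactin_euclidean_iff compactin_imp_closedin)
qed

lemma compact_Pi_UNIV:
  fixes S :: "'i \<Rightarrow> 'a::topological_space set"
  assumes "\<And>i. compact (S i)"
  shows "compact (Pi UNIV S)"
  using assms compactin_PiE[of "\<lambda>_. euclidean" UNIV S]
  by (auto simp: euclidean_product_topology PiE_UNIV_domain Pi_def)

lemma continuous_on_comp_right:
  fixes g :: "'i \<Rightarrow> 'j"
  shows "continuous_on A (\<lambda>f :: 'j \<Rightarrow> 'a::topological_space. f \<circ> g)"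
  by (intro continuous_on_coordinatewise_then_product)
     (auto intro: continuous_on_subset[OF continuous_on_product_coordinates])

text \<open>Ellis-Namakura: only right translations \<open>f \<mapsto> f \<circ> u\<close> need be
  continuous. In a minimal compact subsemigroup \<open>M\<close> they force
  \<open>M \<circ> u = M\<close>, and then the stabiliser of \<open>u\<close> is again all of
  \<open>M\<close>.\<close>

lemma compact_semigroup_idempotent:
  fixes S :: "('a::metric_space \<Rightarrow> 'a) set"
  assumes S: "compact S" "S \<noteq> {}" "\<And>f g. f \<in> S \<Longrightarrow> g \<in> S \<Longrightarrow> f \<circ> g \<in> S"
  obtains u where "u \<in> S" "u \<circ> u = u"
proof -
  define \<A> where
    "\<A> = {M. M \<subseteq> S \<and> compact M \<and> M \<noteq> {} \<and> (\<forall>f\<in>M. \<forall>g\<in>M. f \<circ> g \<in> M)}"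
  \<comment> \<open>Complementation turns the maximal element of Zorn's lemma into a minimal member
    of \<open>\<A>\<close>.\<close>
  have "\<exists>M\<in>uminus ` \<A>. \<forall>N\<in>uminus ` \<A>. M \<subseteq> N \<longrightarrow> N = M"
  proof (rule subset_Zorn_nonempty)
    show "uminus ` \<A> \<noteq> {}"
      using S by (auto simp: \<A>_def)
    fix \<C> assume \<C>: "\<C> \<noteq> {}" "subset.chain (uminus ` \<A>) \<C>"
    define \<D> where "\<D> = uminus ` \<C>"
    have \<D>: "\<D> \<noteq> {}" "\<D> \<subseteq> \<A>"
      using \<C> by (auto simp: \<D>_def subset_chain_def)
    have chain: "M \<subseteq> N \<or> N \<subseteq> M" if "M \<in> \<D>" "N \<in> \<D>" for M N
      using \<C>(2) that unfolding \<D>_def subset_chain_def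
      by (metis (no_types, lifting) Compl_subset_Compl_iff imageE)
    \<comment> \<open>A finite nonempty part of a chain contains its own intersection, so
      compactness makes the whole intersection nonempty.\<close>
    have "S \<inter> \<Inter>\<F> \<noteq> {}" if "finite \<F>" "\<F> \<subseteq> \<D>" for \<F>
    proof (cases "\<F> = {}")
      case False
      have "\<Inter>\<F> \<in> \<F>"
        using that(1) False that(2)
      proof (induction rule: finite_ne_induct)
        case (insert M \<F>)
        then have "\<Inter>\<F> \<subseteq> M \<or> M \<subseteq> \<Inter>\<F>"
          using chain by blast
        then show ?case
          using insert by (auto simp: Int_absorb1 Int_absorb2)
      qed auto
      then have "\<Inter>\<F> \<in> \<A>"
        using that \<D>(2) by blast
      then show ?thesis
        unfolding \<A>_def by blast
    qed (use S in auto)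
    moreover have closed: "closed M" if "M \<in> \<D>" for M
      using that \<D>(2) by (intro compact_fun_imp_closed) (auto simp: \<A>_def)
    ultimately have "S \<inter> \<Inter>\<D> \<noteq> {}"
      using compact_imp_fip[OF S(1), of \<D>] by blast
    moreover have sub: "\<Inter>\<D> \<subseteq> S"
      using \<D> unfolding \<A>_def by blast
    moreover have "closed (\<Inter>\<D>)"
      using closed by (rule closed_Inter[rule_format])
    with sub have "compact (\<Inter>\<D>)"
      using compact_Int_closed[OF S(1)] by (metis Int_absorb1)
    moreover have "f \<circ> g \<in> \<Inter>\<D>" if "f \<in> \<Inter>\<D>" "g \<in> \<Inter>\<D>" for f g
      using that \<D>(2) unfolding \<A>_def by blast
    ultimately have "\<Inter>\<D> \<in> \<A>"
      unfolding \<A>_def by blast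
    moreover have "\<Union>\<C> = - \<Inter>\<D>"
      by (auto simp: \<D>_def)
    ultimately show "\<Union>\<C> \<in> uminus ` \<A>"
      by blast
  qed
  then obtain M where M: "M \<in> \<A>" and min: "\<And>N. N \<in> \<A> \<Longrightarrow> N \<subseteq> M \<Longrightarrow> N = M"
    by auto
  then have MS: "M \<subseteq> S" "compact M" and comp: "\<And>f g. f \<in> M \<Longrightarrow> g \<in> M \<Longrightarrow> f \<circ> g \<in> M"
    by (auto simp: \<A>_def)
  from M obtain u where u: "u \<in> M"
    by (auto simp: \<A>_def)
  have sub: "(\<lambda>f. f \<circ> u) ` M \<subseteq> M"
    using comp u by blast
  have "compact ((\<lambda>f. f \<circ> u) ` M)"
    by (intro compact_continuous_image continuous_on_comp_right MS)
  moreover have "(f \<circ> u) \<circ> (g \<circ> u) \<in> (\<lambda>f. f \<circ> u) ` M" if "f \<in> M" "g \<in> M" for f g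
    using comp[OF comp[OF that(1) u] that(2)] by (metis comp_assoc imageI)
  ultimately have "(\<lambda>f. f \<circ> u) ` M \<in> \<A>"
    using MS(1) sub u unfolding \<A>_def by blast
  then have "(\<lambda>f. f \<circ> u) ` M = M"
    using sub by (rule min)
  then obtain v where v: "v \<in> M" "v \<circ> u = u"
    using u by (metis (no_types, lifting) imageE)
  define N where "N = {f\<in>M. f \<circ> u = u}"
  have "N = M \<inter> (\<lambda>f. f \<circ> u) -` {u}"
    by (auto simp: N_def)
  moreover have "closed ((\<lambda>f :: 'a \<Rightarrow> 'a. f \<circ> u) -` {u})"
    by (intro closed_vimage continuous_on_comp_right compact_fun_imp_closed) auto
  ultimately have "compact N"
    using MS(2) by (simp add: compact_Int_closed)
  moreover have "f \<circ> g \<in> N" if "f \<in> N" "g \<in> N" for f g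
    using that comp by (simp add: N_def comp_assoc)
  ultimately have "N \<in> \<A>"
    using MS(1) v unfolding \<A>_def N_def by blast
  then have "N = M"
    by (rule min) (auto simp: N_def)
  then have "u \<circ> u = u"
    using u by (auto simp: N_def)
  then show thesis
    using that MS(1) u by blast
qed

section \<open>The enveloping semigroup of a distal system\<close>

text \<open>Stands in for a convergent subnet: a compact product with uncountably many factors need
  not be sequentially compact.\<close>

lemma compact_cluster_point:
  fixes h :: "nat \<Rightarrow> 'a::topological_space"
  assumes "compact S" "\<And>k. h k \<in> S"
  obtains l where "l \<in> S" "\<And>W K. open W \<Longrightarrow> l \<in> W \<Longrightarrow> \<exists>k\<ge>K. h k \<in> W"
proof -
  have "filtermap h sequentially \<noteq> bot"
    by (simp add: filtermap_bot_iff)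
  moreover have "\<forall>\<^sub>F x in filtermap h sequentially. x \<in> S"
    using assms(2) by (simp add: eventually_filtermap)
  ultimately obtain l where l: "l \<in> S" "inf (nhds l) (filtermap h sequentially) \<noteq> bot"
    using assms(1) unfolding compact_filter by blast
  have "\<exists>k\<ge>K. h k \<in> W" if "open W" "l \<in> W" for W K
  proof (rule ccontr)
    assume "\<not> (\<exists>k\<ge>K. h k \<in> W)"
    then have "\<forall>\<^sub>F x in filtermap h sequentially. x \<notin> W"
      by (auto simp: eventually_filtermap eventually_sequentially)
    moreover have "\<forall>\<^sub>F x in nhds l. x \<in> W"
      using that by (auto simp: eventually_nhds)
    ultimately have "\<forall>\<^sub>F x in inf (nhds l) (filtermap h sequentially). False"
      unfolding eventually_inf by blast
    then show False
      using l(2) by (simp add: eventually_False)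
  qed
  with l(1) show thesis
    using that by blast
qed

text \<open>
  The iterates are extended by the identity outside \<open>X\<close>, so that as functions on the whole type
  they lie in a compact product of compact sets.
\<close>
definition iter_on :: "'a set \<Rightarrow> ('a \<Rightarrow> 'a) \<Rightarrow> nat \<Rightarrow> 'a \<Rightarrow> 'a" where
  "iter_on X T n = override_on id (T ^^ n) X"

text \<open>The Ellis semigroup; the closure is for pointwise convergence. Times start at 1, as in
  \<open>proximal\<close>.\<close>

definition enveloping :: "'a::metric_space set \<Rightarrow> ('a \<Rightarrow> 'a) \<Rightarrow> ('a \<Rightarrow> 'a) set" where
  "enveloping X T = closure (iter_on X T ` {1..})"

lemma iter_on_eq [simp]: "x \<in> X \<Longrightarrow> iter_on X T n x = (T ^^ n) x"
  and iter_on_outside [simp]: "x \<notin> X \<Longrightarrow> iter_on X T n x = x"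
  by (simp_all add: iter_on_def)

lemma dyn_system_funpow_in: "dyn_system X T \<Longrightarrow> x \<in> X \<Longrightarrow> (T ^^ n) x \<in> X"
  by (induction n) (auto simp: dyn_system_def)

lemma dyn_system_continuous_on_funpow:
  assumes "dyn_system X T"
  shows "continuous_on X (T ^^ n)"
proof (induction n)
  case (Suc n)
  have "(T ^^ n) ` X \<subseteq> X"
    using dyn_system_funpow_in[OF assms] by blast
  then have "continuous_on ((T ^^ n) ` X) T"
    using assms continuous_on_subset unfolding dyn_system_def by blast
  with Suc have "continuous_on X (T \<circ> (T ^^ n))"
    by (rule continuous_on_compose)
  then show ?case
    by simp
qed (simp add: id_def)

text \<open>Finitely many open conditions on orbits share one radius, by continuity of each iterate.
  A triple with \<open>m = 0\<close> restricts the point itself.\<close>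

lemma funpow_uniform_nbhd:
  assumes X: "dyn_system X T" and "finite R"
    and "\<And>m a W. (m, a, W) \<in> R \<Longrightarrow> a \<in> X \<and> open W \<and> (T ^^ m) a \<in> W"
  obtains d where "d > 0"
    "\<And>m a W w. (m, a, W) \<in> R \<Longrightarrow> w \<in> X \<Longrightarrow> dist w a < d \<Longrightarrow> (T ^^ m) w \<in> W"
proof -
  have "\<exists>d>0. \<forall>(m, a, W)\<in>R. \<forall>w\<in>X. dist w a < d \<longrightarrow> (T ^^ m) w \<in> W"
    using assms(2,3)
  proof (induction rule: finite_induct)
    case empty
    then show ?case
      by (auto intro: exI[of _ 1])
  next
    case (insert r R)
    then obtain d where d: "d > 0"
      "\<forall>(m, a, W)\<in>R. \<forall>w\<in>X. dist w a < d \<longrightarrow> (T ^^ m) w \<in> W"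
      by blast
    obtain m a W where r: "r = (m, a, W)"
      using prod_cases3 by blast
    then have aW: "a \<in> X" "open W" "(T ^^ m) a \<in> W"
      using insert.prems by blast+
    then obtain e where e: "e > 0" "ball ((T ^^ m) a) e \<subseteq> W"
      by (meson open_contains_ball)
    obtain d' where d': "d' > 0"
      "\<And>w. w \<in> X \<Longrightarrow> dist w a < d' \<Longrightarrow> dist ((T ^^ m) w) ((T ^^ m) a) < e"
      using dyn_system_continuous_on_funpow[OF X, of m] aW(1) e(1)
      unfolding continuous_on_iff by meson
    have "(T ^^ m) w \<in> W" if "w \<in> X" "dist w a < d'" for w
      using d'(2)[OF that] e(2) by (auto simp: dist_commute)
    then have "\<forall>(m, a, W)\<in>insert r R. \<forall>w\<in>X. dist w a < min d d' \<longrightarrow> (T ^^ m) w \<in> W"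
      using d(2) r by auto
    then show ?case
      using d(1) d'(1) by (meson min_less_iff_conj)
  qed
  with that show thesis
    by blast
qed

lemma iter_on_comp:
  assumes "dyn_system X T"
  shows "iter_on X T m \<circ> iter_on X T n = iter_on X T (m + n)"
  using dyn_system_funpow_in[OF assms]
  by (auto simp: fun_eq_iff iter_on_def override_on_def funpow_add)

lemma enveloping_subset_Pi:
  assumes "dyn_system X T"
  shows "enveloping X T \<subseteq> Pi UNIV (\<lambda>x. if x \<in> X then X else {x})"
proof -
  have "compact (Pi UNIV (\<lambda>x. if x \<in> X then X else {x}))"
    using assms by (intro compact_Pi_UNIV) (auto simp: dyn_system_def)
  then show ?thesis
    unfolding enveloping_def using dyn_system_funpow_in[OF assms]
    by (intro closure_minimal compact_fun_imp_closed) auto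
qed

lemma enveloping_in: "dyn_system X T \<Longrightarrow> p \<in> enveloping X T \<Longrightarrow> x \<in> X \<Longrightarrow> p x \<in> X"
  using enveloping_subset_Pi[of X T] by (auto simp: Pi_iff subset_iff split: if_splits)

lemma enveloping_outside: "dyn_system X T \<Longrightarrow> p \<in> enveloping X T \<Longrightarrow> x \<notin> X \<Longrightarrow> p x = x"
  using enveloping_subset_Pi[of X T] by (auto simp: Pi_iff subset_iff split: if_splits)

lemma compact_enveloping:
  assumes "dyn_system X T"
  shows "compact (enveloping X T)"
proof -
  have "compact (Pi UNIV (\<lambda>x. if x \<in> X then X else {x}))"
    using assms by (intro compact_Pi_UNIV) (auto simp: dyn_system_def)
  from compact_Int_closed[OF this, of "enveloping X T"] show ?thesis
    using enveloping_subset_Pi[OF assms] by (simp add: enveloping_def Int_absorb1)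
qed

lemma iter_on_in_enveloping: "n \<ge> 1 \<Longrightarrow> iter_on X T n \<in> enveloping X T"
  unfolding enveloping_def by (intro closure_subset[THEN subsetD]) auto

lemma open_pointwise_ball:
  fixes p :: "'i \<Rightarrow> 'a::metric_space"
  assumes "finite F"
  shows "open {f. \<forall>x\<in>F. dist (f x) (p x) < e}"
  using product_topology_basis'[of F "\<lambda>x. ball (p x) e" "\<lambda>x. x"] assms
  by (simp add: dist_commute)

lemma enveloping_approx:
  assumes "p \<in> enveloping X T" "finite F" "e > 0"
  shows "\<exists>n\<ge>1. \<forall>x\<in>F. dist (iter_on X T n x) (p x) < e"
proof -
  have "p \<in> {f. \<forall>x\<in>F. dist (f x) (p x) < e}"
    using assms(3) by simp
  then have "iter_on X T ` {1..} \<inter> {f. \<forall>x\<in>F. dist (f x) (p x) < e} \<noteq> {}"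
    using assms(1) open_pointwise_ball[OF assms(2), of p e]
    unfolding enveloping_def closure_iff_nhds_not_empty by blast
  then show ?thesis
    by auto
qed

text \<open>Two closure arguments, in this order: left composition with an iterate is continuous
  because the iterate is, and right composition with any \<open>g\<close> always is. Left
  composition with a general limit map need not be.\<close>

lemma enveloping_comp:
  assumes X: "dyn_system X T" and f: "f \<in> enveloping X T" and g: "g \<in> enveloping X T"
  shows "f \<circ> g \<in> enveloping X T"
proof -
  have left: "iter_on X T n \<circ> g \<in> enveloping X T" if "g \<in> enveloping X T" "n \<ge> 1" for g n
  proof -
    have "continuous_on (enveloping X T) (\<lambda>g. iter_on X T n (g x))" for x
    proof (cases "x \<in> X")
      case True
      have "continuous_on (enveloping X T) (\<lambda>g. g x)"
        by (rule continuous_on_subset[OF continuous_on_product_coordinates]) simp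
      moreover have "(\<lambda>g. g x) ` enveloping X T \<subseteq> X"
        using True enveloping_in[OF X] by blast
      ultimately have "continuous_on (enveloping X T) (\<lambda>g. (T ^^ n) (g x))"
        by (rule continuous_on_compose2[OF dyn_system_continuous_on_funpow[OF X]])
      then show ?thesis
        using True enveloping_in[OF X]
        by (subst continuous_on_cong[OF refl, where g = "\<lambda>g. (T ^^ n) (g x)"]) auto
    next
      case False
      then have "iter_on X T n (g x) = x" if "g \<in> enveloping X T" for g
        using enveloping_outside[OF X that] by simp
      then show ?thesis
        by (subst continuous_on_cong[OF refl, where g = "\<lambda>_. x"]) auto
    qed
    then have "continuous_on (enveloping X T) (\<lambda>g. iter_on X T n \<circ> g)"
      by (intro continuous_on_coordinatewise_then_product) simp
    moreover have "(\<lambda>g. iter_on X T n \<circ> g) ` iter_on X T ` {1..} \<subseteq> enveloping X T"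
      using that by (auto simp: iter_on_comp[OF X] intro!: iter_on_in_enveloping)
    ultimately have "(\<lambda>g. iter_on X T n \<circ> g) ` enveloping X T \<subseteq> enveloping X T"
      unfolding enveloping_def by (intro image_closure_subset) auto
    then show ?thesis
      using that by auto
  qed
  have "(\<lambda>f. f \<circ> g) ` closure (iter_on X T ` {1..}) \<subseteq> enveloping X T"
    using left[OF g]
    by (intro image_closure_subset continuous_on_comp_right) (auto simp: enveloping_def)
  then show ?thesis
    using f by (auto simp: enveloping_def)
qed

text \<open>An idempotent \<open>u\<close> takes the same value at \<open>x\<close> and
  \<open>u x\<close>. Iterates approximating \<open>u\<close> at both points bring their orbits
  together, so the two points are proximal.\<close>

lemma distal_enveloping_idempotent:
  assumes X: "dyn_system X T" "distal X T" and u: "u \<in> enveloping X T" "u \<circ> u = u"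
  shows "u = id"
proof
  fix x
  show "u x = id x"
  proof (cases "x \<in> X")
    case True
    then have ux: "u x \<in> X"
      using X u by (simp add: enveloping_in)
    have uux: "u (u x) = u x"
      using u(2) by (metis comp_apply)
    have "\<exists>n\<ge>1. dist ((T ^^ n) x) ((T ^^ n) (u x)) < e" if "e > 0" for e
    proof -
      have "finite {x, u x}" "e / 2 > 0"
        using that by simp_all
      from enveloping_approx[OF u(1) this] obtain n where n: "n \<ge> 1"
        "dist (iter_on X T n x) (u x) < e / 2" "dist (iter_on X T n (u x)) (u (u x)) < e / 2"
        by blast
      have "dist ((T ^^ n) x) (u x) < e / 2" "dist ((T ^^ n) (u x)) (u x) < e / 2"
        using n(2,3) uux True ux by simp_all
      then have "dist ((T ^^ n) x) ((T ^^ n) (u x)) < e"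
        by (rule dist_triangle_half_l)
      with n(1) show ?thesis
        by blast
    qed
    moreover have "bdd_below ((\<lambda>n. dist ((T ^^ n) x) ((T ^^ n) (u x))) ` {1..})"
      by (rule bdd_belowI2[of _ 0]) simp
    ultimately have "(INF n\<in>{1..}. dist ((T ^^ n) x) ((T ^^ n) (u x))) < e" if "e > 0" for e
      using that by (subst cINF_less_iff) auto
    moreover have "0 \<le> (INF n\<in>{1::nat..}. dist ((T ^^ n) x) ((T ^^ n) (u x)))"
      by (rule cINF_greatest) auto
    ultimately have "proximal X T x (u x)"
      unfolding proximal_def by (meson less_irrefl order.antisym not_less)
    then show ?thesis
      using X(2) True ux unfolding distal_def by (metis id_apply)
  qed (use X u in \<open>simp add: enveloping_outside\<close>)
qed

text \<open>The left ideal of all \<open>f \<circ> p\<close> is a compact semigroup, and its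
  idempotent must be the identity.\<close>

lemma distal_enveloping_left_inverse:
  assumes X: "dyn_system X T" "distal X T" and p: "p \<in> enveloping X T"
  obtains q where "q \<in> enveloping X T" "q \<circ> p = id"
proof -
  have "compact ((\<lambda>f. f \<circ> p) ` enveloping X T)"
    by (intro compact_continuous_image continuous_on_comp_right compact_enveloping X)
  moreover have "(\<lambda>f. f \<circ> p) ` enveloping X T \<noteq> {}"
    using p by blast
  moreover have "f \<circ> g \<in> (\<lambda>f. f \<circ> p) ` enveloping X T"
    if "f \<in> (\<lambda>f. f \<circ> p) ` enveloping X T" "g \<in> (\<lambda>f. f \<circ> p) ` enveloping X T" for f g
    using that p by (auto simp: enveloping_comp[OF X(1)] simp flip: comp_assoc)
  ultimately obtain u where u: "u \<in> (\<lambda>f. f \<circ> p) ` enveloping X T" "u \<circ> u = u"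
    by (rule compact_semigroup_idempotent)
  then obtain q where q: "q \<in> enveloping X T" "u = q \<circ> p"
    by blast
  then have "u = id"
    using X p u(2) by (intro distal_enveloping_idempotent[OF X]) (simp_all add: enveloping_comp)
  with q that show thesis
    by blast
qed

section \<open>From failure of equicontinuity to approximate recurrence\<close>

proposition distal_sensitive_recurrence:
  assumes X: "dyn_system X T" "distal X T" and neq: "\<not> equicontinuous_sys X T"
  obtains x0 z0 where "x0 \<in> X" "z0 \<in> X" "x0 \<noteq> z0"
    "\<And>F d. finite F \<Longrightarrow> F \<subseteq> X \<Longrightarrow> d > 0 \<Longrightarrow>
      \<exists>n. \<exists>x\<in>X. dist x x0 < d \<and> dist ((T ^^ n) x) z0 < d \<and> (\<forall>a\<in>F. dist ((T ^^ n) a) a < d)"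
proof -
  let ?E = "enveloping X T"
  obtain x0 e where x0: "x0 \<in> X" "e > 0"
    "\<And>d. d > 0 \<Longrightarrow> \<exists>y\<in>X. dist x0 y < d \<and> (\<exists>n. e \<le> dist ((T ^^ n) x0) ((T ^^ n) y))"
    using neq unfolding equicontinuous_sys_def by (meson not_less)
  \<comment> \<open>The bound \<open>e\<close> excludes time 0, so the chosen iterates belong to the
    enveloping semigroup; the bound \<open>1 / Suc k\<close> makes the points converge to
    \<open>x0\<close>.\<close>
  have "\<exists>y n. y \<in> X \<and> dist x0 y < min e (1 / Suc k) \<and> e \<le> dist ((T ^^ n) x0) ((T ^^ n) y)"
    for k
    using x0(2) x0(3)[of "min e (1 / Suc k)"] by auto
  then obtain y n where y: "\<And>k. y k \<in> X" "\<And>k. dist x0 (y k) < min e (1 / Suc k)"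
    and yn: "\<And>k. e \<le> dist ((T ^^ n k) x0) ((T ^^ n k) (y k))"
    by metis
  have n1: "n k \<ge> 1" for k
    using y(2)[of k] yn[of k] by (cases "n k") auto
  have "compact (?E \<times> X)"
    using X by (intro compact_Times compact_enveloping) (auto simp: dyn_system_def)
  moreover have "(iter_on X T (n k), (T ^^ n k) (y k)) \<in> ?E \<times> X" for k
    using n1 y(1) X(1) by (auto intro: iter_on_in_enveloping dyn_system_funpow_in)
  ultimately obtain l where "l \<in> ?E \<times> X" and l: "\<And>W K. open W \<Longrightarrow> l \<in> W \<Longrightarrow>
      \<exists>k\<ge>K. (iter_on X T (n k), (T ^^ n k) (y k)) \<in> W"
    using compact_cluster_point[of "?E \<times> X" "\<lambda>k. (iter_on X T (n k), (T ^^ n k) (y k))"] by blast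
  then obtain p z where p: "p \<in> ?E" and z: "z \<in> X" and lpz: "l = (p, z)"
    by auto
  have cluster: "\<exists>k\<ge>K. dist ((T ^^ n k) (y k)) z < d \<and> (\<forall>a\<in>F. dist ((T ^^ n k) a) (p a) < d)"
    if "finite F" "F \<subseteq> X" "d > 0" for F d K
  proof -
    have "open ({f. \<forall>a\<in>F. dist (f a) (p a) < d} \<times> ball z d)"
      using that by (intro open_Times open_pointwise_ball) auto
    from l[OF this, of K] that show ?thesis
      by (auto simp: lpz dist_commute subset_iff)
  qed
  obtain q where q: "q \<in> ?E" "q \<circ> p = id"
    using distal_enveloping_left_inverse[OF X p] .
  \<comment> \<open>A left inverse of \<open>q\<close> makes \<open>q\<close> injective, so
    \<open>q\<close> keeps \<open>p x0\<close> and \<open>z\<close> apart.\<close>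
  obtain r where r: "r \<circ> q = id"
    using distal_enveloping_left_inverse[OF X q(1)] .
  have "p x0 \<noteq> z"
  proof
    assume "p x0 = z"
    have "finite {x0}" "{x0} \<subseteq> X" "e / 2 > 0"
      using x0(1,2) by simp_all
    from cluster[OF this] obtain k
      where k: "dist ((T ^^ n k) (y k)) z < e / 2" "dist ((T ^^ n k) x0) (p x0) < e / 2"
      by blast
    have "dist ((T ^^ n k) x0) ((T ^^ n k) (y k)) < e"
      using k(2,1) unfolding \<open>p x0 = z\<close> by (rule dist_triangle_half_l)
    with yn[of k] show False
      by simp
  qed
  then have "q (p x0) \<noteq> q z"
    using r by (metis comp_apply id_apply)
  then have "x0 \<noteq> q z"
    using q(2) by (metis comp_apply id_apply)
  moreover have "\<exists>n. \<exists>x\<in>X. dist x x0 < d \<and> dist ((T ^^ n) x) (q z) < d \<and>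
      (\<forall>a\<in>F. dist ((T ^^ n) a) a < d)"
    if F: "finite F" "F \<subseteq> X" and "d > 0" for F d
  proof -
    \<comment> \<open>Since \<open>q\<close> may be discontinuous, it is replaced by one iterate
      \<open>T ^^ m\<close> close to it on \<open>?G\<close>; continuity of that iterate then
      absorbs the error of \<open>T ^^ n k\<close>.\<close>
    let ?G = "insert z (p ` F)"
    have G: "?G \<subseteq> X"
      using F z enveloping_in[OF X(1) p] by auto
    have "finite ?G"
      using F(1) by simp
    from enveloping_approx[OF q(1) this \<open>d > 0\<close>] obtain m
      where m: "\<And>a. a \<in> ?G \<Longrightarrow> dist (iter_on X T m a) (q a) < d"
      by blast
    define R where "R = (\<lambda>a. (m, a, ball (q a) d)) ` ?G"
    have "finite R"
      using F(1) by (simp add: R_def)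
    moreover have "a \<in> X \<and> open W \<and> (T ^^ l) a \<in> W" if "(l, a, W) \<in> R" for l a W
    proof -
      have "a \<in> ?G" "l = m" "W = ball (q a) d"
        using that by (auto simp: R_def)
      moreover from this have "a \<in> X"
        using G by blast
      ultimately show ?thesis
        using m[of a] by (simp add: dist_commute)
    qed
    ultimately obtain c where c: "c > 0"
      "\<And>l a W w. (l, a, W) \<in> R \<Longrightarrow> w \<in> X \<Longrightarrow> dist w a < c \<Longrightarrow> (T ^^ l) w \<in> W"
      by (rule funpow_uniform_nbhd[OF X(1)]) blast+
    have close: "dist ((T ^^ m) b) (q a) < d" if "a \<in> ?G" "b \<in> X" "dist b a < c" for a b
    proof -
      have "(m, a, ball (q a) d) \<in> R"
        using that(1) by (auto simp: R_def)
      from c(2)[OF this that(2,3)] show ?thesis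
        by (simp add: dist_commute)
    qed
    obtain K :: nat where "1 / d < K"
      using reals_Archimedean2 by blast
    from cluster[OF F c(1), of K] obtain k where k: "k \<ge> K" "dist ((T ^^ n k) (y k)) z < c"
      "\<And>a. a \<in> F \<Longrightarrow> dist ((T ^^ n k) a) (p a) < c"
      by blast
    have "1 / d < Suc k"
      using k(1) \<open>1 / d < K\<close> by linarith
    then have "1 / Suc k < d"
      using \<open>d > 0\<close> by (simp add: field_simps)
    then have "dist (y k) x0 < d"
      using y(2)[of k] by (simp add: dist_commute)
    moreover have "dist ((T ^^ (m + n k)) (y k)) (q z) < d"
      using close[OF insertI1 dyn_system_funpow_in[OF X(1) y(1)] k(2)] by (simp add: funpow_add)
    moreover have "dist ((T ^^ (m + n k)) a) a < d" if "a \<in> F" for a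
    proof -
      have "(T ^^ n k) a \<in> X"
        using that F(2) X(1) by (blast intro: dyn_system_funpow_in)
      then have "dist ((T ^^ m) ((T ^^ n k) a)) (q (p a)) < d"
        using that k(3) by (intro close) blast+
      then show ?thesis
        using pointfree_idE[OF q(2)] by (simp add: funpow_add)
    qed
    ultimately show ?thesis
      using y(1) by blast
  qed
  ultimately show thesis
    by (rule that[OF x0(1) enveloping_in[OF X(1) q(1) z]])
qed

section \<open>Independent sets of times\<close>

text \<open>
  The times \<open>c J\<close> are sums of the \<open>n\<close>'s produced by successive applications of
  \<open>recurrence\<close>, taken over the indices in \<open>J\<close>; reserving the indices \<open>0\<close> and \<open>1\<close> for the
  points \<open>x0\<close> and \<open>z0\<close> makes the induction step uniform.
\<close>
lemma shattering_times:
  assumes X: "dyn_system X T" and x0: "x0 \<in> X" "open U" "x0 \<in> U" and z0: "z0 \<in> X" "open V" "z0 \<in> V"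
    and recurrence: "\<And>F d. finite F \<Longrightarrow> F \<subseteq> X \<Longrightarrow> d > 0 \<Longrightarrow>
      \<exists>n. \<exists>x\<in>X. dist x x0 < d \<and> dist ((T ^^ n) x) z0 < d \<and> (\<forall>a\<in>F. dist ((T ^^ n) a) a < d)"
  shows "\<exists>(c :: nat set \<Rightarrow> nat) x. finite (range c) \<and> x 0 = x0 \<and> x 1 = z0 \<and>
    (\<forall>i<N + 2. x i \<in> X \<and> (\<forall>J. 0 \<notin> J \<longrightarrow> 1 \<in> J \<longrightarrow> (T ^^ c J) (x i) \<in> (if i \<in> J then V else U)))"
proof (induction N)
  case 0
  define x where "x = (\<lambda>i::nat. if i = 0 then x0 else z0)"
  have "\<forall>i<0 + 2. x i \<in> X \<and>
      (\<forall>J. 0 \<notin> J \<longrightarrow> 1 \<in> J \<longrightarrow> (T ^^ 0) (x i) \<in> (if i \<in> J then V else U))"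
    using x0 z0 by (auto simp: x_def less_Suc_eq)
  then show ?case
    by (intro exI[of _ "\<lambda>_. 0"] exI[of _ x]) (simp add: x_def)
next
  case (Suc N)
  then obtain c x where c: "finite (range (c :: nat set \<Rightarrow> nat))" and x: "x 0 = x0" "x 1 = z0"
    "\<And>i. i < N + 2 \<Longrightarrow> x i \<in> X"
    and cx: "\<And>i J. i < N + 2 \<Longrightarrow> 0 \<notin> J \<Longrightarrow> 1 \<in> J \<Longrightarrow>
      (T ^^ c J) (x i) \<in> (if i \<in> J then V else U)"
    by auto
  define P where "P = range c \<times> x ` {..<N + 2} \<times> {U, V}"
  \<comment> \<open>The first kind of triple lets the new point and its image inherit the behaviour
    of \<open>x0\<close> and \<open>z0\<close>. The second, with time 0, keeps points already in
    \<open>U\<close> or \<open>V\<close> there after a further \<open>T ^^ n\<close>.\<close>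
  define R where "R = {(m, a, W). (m, a, W) \<in> P \<and> (T ^^ m) a \<in> W} \<union>
    (\<lambda>(m, a, W). (0, (T ^^ m) a, W)) ` {(m, a, W). (m, a, W) \<in> P \<and> (T ^^ m) a \<in> W}"
  have "finite P"
    using c by (simp add: P_def)
  then have "finite {(m, a, W). (m, a, W) \<in> P \<and> (T ^^ m) a \<in> W}"
    by (rule rev_finite_subset) auto
  then have "finite R"
    by (simp add: R_def)
  moreover have "a \<in> X \<and> open W \<and> (T ^^ m) a \<in> W" if "(m, a, W) \<in> R" for m a W
    using that x(3) x0(2) z0(2) dyn_system_funpow_in[OF X] by (auto simp: R_def P_def)
  ultimately obtain d where d: "d > 0"
    "\<And>m a W w. (m, a, W) \<in> R \<Longrightarrow> w \<in> X \<Longrightarrow> dist w a < d \<Longrightarrow> (T ^^ m) w \<in> W"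
    by (rule funpow_uniform_nbhd[OF X]) blast+
  define F where "F = (\<lambda>(m, a). (T ^^ m) a) ` (range c \<times> x ` {..<N + 2})"
  have "finite F" "F \<subseteq> X"
    using c x(3) dyn_system_funpow_in[OF X] by (auto simp: F_def)
  from recurrence[OF this d(1)] obtain n y where y: "y \<in> X" "dist y x0 < d" "dist ((T ^^ n) y) z0 < d"
    and n: "\<And>a. a \<in> F \<Longrightarrow> dist ((T ^^ n) a) a < d"
    by blast
  define c' where "c' = (\<lambda>J. if N + 2 \<in> J then n + c J else c J)"
  define x' where "x' = x(N + 2 := y)"
  have "range c' \<subseteq> range c \<union> (+) n ` range c"
    by (auto simp: c'_def)
  then have "finite (range c')"
    using c by (meson finite_UnI finite_imageI finite_subset)
  moreover have "x' 0 = x0" "x' 1 = z0"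
    using x by (auto simp: x'_def)
  moreover have "x' i \<in> X" if "i < Suc N + 2" for i
    using that x(3) y(1) by (auto simp: x'_def)
  moreover have "(T ^^ c' J) (x' i) \<in> (if i \<in> J then V else U)"
    if "i < Suc N + 2" and J: "0 \<notin> J" "1 \<in> J" for i J
  proof (cases "i = N + 2")
    case True
    \<comment> \<open>The reserved indices act here: \<open>0 \<notin> J\<close> and
      \<open>1 \<in> J\<close> say that \<open>T ^^ c J\<close> keeps \<open>x0\<close> in
      \<open>U\<close> and \<open>z0\<close> in \<open>V\<close>.\<close>
    have "(c J, x0, U) \<in> R" "(c J, z0, V) \<in> R"
      using cx[of 0 J] cx[of 1 J] J x(1,2) by (force simp: R_def P_def)+
    from d(2)[OF this(1) y(1,2)] d(2)[OF this(2) dyn_system_funpow_in[OF X y(1)] y(3)]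
    show ?thesis
      using True by (simp add: c'_def x'_def funpow_add funpow_swap1 add.commute[of n])
  next
    case False
    then have i: "i < N + 2"
      using that(1) by simp
    let ?W = "if i \<in> J then V else U"
    have "(c J, x i, ?W) \<in> P"
      using i by (simp add: P_def)
    then have "(0, (T ^^ c J) (x i), ?W) \<in> R"
      unfolding R_def using cx[OF i J]
      by (intro UnI2 image_eqI[where x = "(c J, x i, ?W)"]) simp_all
    moreover have "(T ^^ c J) (x i) \<in> F"
      using i by (auto simp: F_def)
    ultimately have "(T ^^ n) ((T ^^ c J) (x i)) \<in> ?W"
      using d(2)[of 0 _ ?W] n x(3)[OF i] dyn_system_funpow_in[OF X]
      by (metis funpow_0)
    then show ?thesis
      using cx[OF i J] False
      by (cases "N + 2 \<in> J") (simp_all add: c'_def x'_def funpow_add split del: if_split)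
  qed
  ultimately show ?case
    by blast
qed

definition independent_times ::
    "'a set \<Rightarrow> ('a \<Rightarrow> 'a) \<Rightarrow> 'a set \<Rightarrow> 'a set \<Rightarrow> nat set \<Rightarrow> bool" where
  "independent_times X T A B G \<longleftrightarrow>
     (\<forall>S\<subseteq>G. \<exists>w\<in>X. \<forall>s\<in>G. (T ^^ s) w \<in> (if s \<in> S then B else A))"

lemma independent_times_mono:
  assumes "independent_times X T A B G" "A \<subseteq> A'" "B \<subseteq> B'" "H \<subseteq> G"
  shows "independent_times X T A' B' H"
  unfolding independent_times_def
proof (intro allI impI)
  fix S assume "S \<subseteq> H"
  then have "S \<subseteq> G"
    using assms(4) by blast
  then obtain w where w: "w \<in> X" "\<forall>s\<in>G. (T ^^ s) w \<in> (if s \<in> S then B else A)"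
    using assms(1) unfolding independent_times_def by blast
  have "(T ^^ s) w \<in> (if s \<in> S then B' else A')" if "s \<in> H" for s
    using w(2) that assms(2-4) by (cases "s \<in> S") fastforce+
  with w(1) show "\<exists>w\<in>X. \<forall>s\<in>H. (T ^^ s) w \<in> (if s \<in> S then B' else A')"
    by blast
qed

text \<open>Points are indexed by the subsets \<open>S\<close> of \<open>{..<m}\<close>, and the
  time for \<open>j\<close> uses the index set of all \<open>S\<close> containing \<open>j\<close>.
  Membership \<open>j \<in> S\<close> then decides between \<open>V\<close> and
  \<open>U\<close>.\<close>

proposition independent_times_of_recurrence:
  assumes X: "dyn_system X T" and x0: "x0 \<in> X" "open U" "x0 \<in> U" and z0: "z0 \<in> X" "open V" "z0 \<in> V"
    and recurrence: "\<And>F d. finite F \<Longrightarrow> F \<subseteq> X \<Longrightarrow> d > 0 \<Longrightarrow>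
      \<exists>n. \<exists>x\<in>X. dist x x0 < d \<and> dist ((T ^^ n) x) z0 < d \<and> (\<forall>a\<in>F. dist ((T ^^ n) a) a < d)"
    and "U \<inter> V = {}"
  shows "\<exists>G. finite G \<and> card G = m \<and> independent_times X T U V G"
proof -
  \<comment> \<open>The shift by 2 avoids the reserved indices 0 and 1.\<close>
  define \<iota> where "\<iota> = (\<lambda>S. set_encode S + 2)"
  define J where "J = (\<lambda>j. insert 1 (\<iota> ` {S. S \<subseteq> {..<m} \<and> j \<in> S}))"
  have "finite (\<iota> ` Pow {..<m})"
    by simp
  then obtain N where N: "\<And>S. S \<subseteq> {..<m} \<Longrightarrow> \<iota> S < N + 2"
    unfolding finite_nat_set_iff_bounded by (metis PowI imageI trans_less_add1)
  obtain c x where cx: "\<And>i. i < N + 2 \<Longrightarrow> x i \<in> X \<and>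
      (\<forall>J. 0 \<notin> J \<longrightarrow> 1 \<in> J \<longrightarrow> (T ^^ c J) (x i) \<in> (if i \<in> J then V else U))"
    using shattering_times[OF X x0 z0 recurrence, of N] by blast
  have mem: "\<iota> S \<in> J j \<longleftrightarrow> j \<in> S" if "S \<subseteq> {..<m}" for S j
  proof -
    have "inj_on \<iota> (Pow {..<m})"
      using finite_subset[OF _ finite_lessThan[of m]]
      by (auto simp: inj_on_def \<iota>_def set_encode_eq)
    then show ?thesis
      using that by (auto simp: J_def \<iota>_def inj_on_def)
  qed
  define t where "t = c \<circ> J"
  have t: "(T ^^ t j) (x (\<iota> S)) \<in> (if j \<in> S then V else U)" if "S \<subseteq> {..<m}" for S j
  proof -
    have "0 \<notin> J j" "1 \<in> J j"
      by (auto simp: J_def \<iota>_def)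
    then show ?thesis
      using cx[OF N[OF that], THEN conjunct2, rule_format, of "J j"] mem[OF that, of j] unfolding t_def
      by simp
  qed
  \<comment> \<open>If two of the times agreed, the point for \<open>{i}\<close> would be sent into
    both \<open>U\<close> and \<open>V\<close>.\<close>
  have "inj_on t {..<m}"
  proof (rule inj_onI, rule ccontr)
    fix i j assume ij: "i \<in> {..<m}" "j \<in> {..<m}" "t i = t j" "i \<noteq> j"
    show False
      using t[of "{i}" i] t[of "{i}" j] ij \<open>U \<inter> V = {}\<close> by auto
  qed
  moreover have "independent_times X T U V (t ` {..<m})"
    unfolding independent_times_def
  proof (intro allI impI)
    fix S
    define S' where "S' = {j\<in>{..<m}. t j \<in> S}"
    have S': "S' \<subseteq> {..<m}"
      by (auto simp: S'_def)
    have "(T ^^ s) (x (\<iota> S')) \<in> (if s \<in> S then V else U)" if "s \<in> t ` {..<m}" for s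
    proof -
      obtain j where "j < m" "s = t j"
        using \<open>s \<in> t ` {..<m}\<close> by blast
      then show ?thesis
        using t[OF S', of j] by (simp add: S'_def split del: if_split)
    qed
    moreover have "x (\<iota> S') \<in> X"
      using cx[OF N[OF S']] by (rule conjunct1)
    ultimately show "\<exists>w\<in>X. \<forall>s\<in>t ` {..<m}. (T ^^ s) w \<in> (if s \<in> S then V else U)"
      by blast
  qed
  ultimately show ?thesis
    by (intro exI[of _ "t ` {..<m}"]) (simp add: card_image)
qed

section \<open>Sequence entropy\<close>

lemma finite_join_cover:
  assumes "finite U"
  shows "finite (join_cover X T t U n)"
proof -
  have "join_cover X T t U n \<subseteq>
      (\<lambda>f. X \<inter> (\<Inter>i<n. (T ^^ t i) -` f i)) ` (\<Pi>\<^sub>E i\<in>{..<n}. U)"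
  proof
    fix C assume "C \<in> join_cover X T t U n"
    then obtain f where f: "C = X \<inter> (\<Inter>i<n. (T ^^ t i) -` f i)" "\<forall>i<n. f i \<in> U"
      by (auto simp: join_cover_def)
    then have "C = X \<inter> (\<Inter>i<n. (T ^^ t i) -` restrict f {..<n} i)"
      by auto
    then show "C \<in> (\<lambda>f. X \<inter> (\<Inter>i<n. (T ^^ t i) -` f i)) ` (\<Pi>\<^sub>E i\<in>{..<n}. U)"
      using f(2) by (intro image_eqI[of _ _ "restrict f {..<n}"]) auto
  qed
  then show ?thesis
    using assms by (meson finite_PiE finite_imageI finite_lessThan finite_subset)
qed

lemma join_cover_covers:
  assumes "dyn_system X T" "X \<subseteq> \<Union>U"
  shows "X \<subseteq> \<Union>(join_cover X T t U n)"
proof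
  fix x assume x: "x \<in> X"
  then have "\<exists>V\<in>U. (T ^^ t i) x \<in> V" for i
    using assms dyn_system_funpow_in[OF assms(1)] by blast
  then obtain f where "\<And>i. f i \<in> U" "\<And>i. (T ^^ t i) x \<in> f i"
    by metis
  then show "x \<in> \<Union>(join_cover X T t U n)"
    using x by (auto simp: join_cover_def)
qed

text \<open>Each member of the join avoids \<open>A\<close> or \<open>B\<close> at every listed
  time. Witnesses for different subsets of \<open>G\<close> are in different sets at some time of
  \<open>G\<close>, so no member contains both.\<close>

lemma independent_times_cover_num:
  assumes X: "dyn_system X T" and AB: "A \<inter> B = {}" and G: "independent_times X T A B G"
    "finite G" "G \<subseteq> t ` {..<n}"
  shows "2 ^ card G \<le> cover_num X (join_cover X T t {X - A, X - B} n)"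
proof -
  let ?U = "join_cover X T t {X - A, X - B} n"
  have "finite ?U"
    by (simp add: finite_join_cover)
  moreover have "X \<subseteq> \<Union>?U"
    using AB by (intro join_cover_covers[OF X]) auto
  ultimately have "\<exists>k. \<exists>W\<subseteq>?U. finite W \<and> card W = k \<and> X \<subseteq> \<Union>W"
    by (metis order_refl)
  then have "\<exists>W\<subseteq>?U. finite W \<and> card W = cover_num X ?U \<and> X \<subseteq> \<Union>W"
    unfolding cover_num_def by (rule LeastI_ex)
  then obtain W where W: "W \<subseteq> ?U" "finite W" "card W = cover_num X ?U" "X \<subseteq> \<Union>W"
    by blast
  define P where "P S w \<longleftrightarrow> w \<in> X \<and> (\<forall>s\<in>G. (T ^^ s) w \<in> (if s \<in> S then B else A))" for S w
  have "\<exists>w. P S w" if "S \<subseteq> G" for S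
    using G(1) that unfolding independent_times_def P_def by blast
  then obtain w where Pw: "\<And>S. S \<subseteq> G \<Longrightarrow> P S (w S)"
    by metis
  have w: "w S \<in> X" if "S \<subseteq> G" for S
    using Pw[OF that] unfolding P_def by (rule conjunct1)
  have wT: "(T ^^ s) (w S) \<in> (if s \<in> S then B else A)" if "S \<subseteq> G" "s \<in> G" for S s
    by (rule bspec[OF conjunct2[OF Pw[OF that(1), unfolded P_def]] that(2)])
  have "\<exists>D. D \<in> W \<and> w S \<in> D" if "S \<subseteq> G" for S
  proof -
    from W(4) w[OF that] have "w S \<in> \<Union>W" ..
    then show ?thesis
      by blast
  qed
  then obtain C where C: "\<And>S. S \<subseteq> G \<Longrightarrow> C S \<in> W \<and> w S \<in> C S"
    by metis
  \<comment> \<open>One inclusion is enough, since the hypotheses are symmetric in \<open>S\<close>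
    and \<open>S'\<close>.\<close>
  have sub: "S \<subseteq> S'" if S: "S \<subseteq> G" "S' \<subseteq> G" "C S = C S'" for S S'
  proof
    fix s assume "s \<in> S"
    show "s \<in> S'"
    proof (rule ccontr)
      assume "s \<notin> S'"
      have "s \<in> G"
        using \<open>s \<in> S\<close> S(1) by blast
      then obtain i where i: "i < n" "s = t i"
        using G(3) by auto
      have "C S \<in> ?U"
        using C W(1) S(1) by blast
      then obtain f where f: "C S = X \<inter> (\<Inter>i<n. (T ^^ t i) -` f i)" "\<forall>i<n. f i \<in> {X - A, X - B}"
        unfolding join_cover_def by blast
      have "f i \<in> {X - A, X - B}" "C S \<subseteq> (T ^^ s) -` f i"
        using f i by auto
      moreover have "(T ^^ s) (w S) \<in> B" "(T ^^ s) (w S') \<in> A"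
        using wT[OF S(1) \<open>s \<in> G\<close>] wT[OF S(2) \<open>s \<in> G\<close>] \<open>s \<in> S\<close> \<open>s \<notin> S'\<close> by auto
      ultimately show False
        using C[OF S(1)] C[OF S(2)] S(3) by auto
    qed
  qed
  have "inj_on C (Pow G)"
  proof (rule inj_onI)
    fix S S' assume "S \<in> Pow G" "S' \<in> Pow G" "C S = C S'"
    then show "S = S'"
      using sub[of S S'] sub[of S' S] by simp
  qed
  then have "card (Pow G) \<le> card W"
    using C W(2) by (intro card_inj_on_le[of C]) auto
  then show ?thesis
    using W(3) G(2) by (simp add: card_Pow)
qed

proposition independent_times_not_null:
  assumes X: "dyn_system X T" and AB: "closed A" "closed B" "A \<inter> B = {}"
    and indep: "\<And>m. \<exists>G. finite G \<and> card G = m \<and> independent_times X T A B G"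
  shows "\<not> null_sys X T"
proof
  assume null: "null_sys X T"
  \<comment> \<open>With more than \<open>b\<close> independent times, all \<open>\<ge> b\<close>, the block outnumbers everything chosen before it.\<close>
  have "\<exists>G. finite G \<and> card G = Suc b \<and> G \<subseteq> {b..} \<and> independent_times X T A B G" for b
  proof -
    obtain H where H: "finite H" "card H = Suc b + b" "independent_times X T A B H"
      using indep by blast
    have "card H \<le> card (H - {..<b}) + card {..<b}"
      using H(1) card_Un_le[of "H - {..<b}" "{..<b}"]
        card_mono[of "H - {..<b} \<union> {..<b}" H] by fastforce
    then have "Suc b \<le> card (H - {..<b})"
      using H(2) by simp
    then obtain G where "G \<subseteq> H - {..<b}" "card G = Suc b" "finite G"
      by (rule obtain_subset_with_card_n)
    then show ?thesis
      using independent_times_mono[OF H(3) order_refl order_refl, of G] by fastforce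
  qed
  then obtain pick where pick: "\<And>b. finite (pick b)" "\<And>b. card (pick b) = Suc b"
    "\<And>b. pick b \<subseteq> {b..}" "\<And>b. independent_times X T A B (pick b)"
    by metis
  \<comment> \<open>Each block starts beyond the maximum of the previous one, so block
    \<open>k\<close> lies in the interval from \<open>b k\<close> to below
    \<open>b (Suc k)\<close>.\<close>
  define b where "b = rec_nat 0 (\<lambda>_ b. Suc (Max (pick b)))"
  have b_Suc: "b (Suc k) = Suc (Max (pick (b k)))" for k
    by (simp add: b_def)
  have pick_b: "b k \<le> s" "s < b (Suc k)" if "s \<in> pick (b k)" for s k
    using that pick(1,3) by (auto simp: b_Suc less_Suc_eq_le)
  have "pick (b k) \<noteq> {}" for k
    using pick(2)[of "b k"] by auto
  then have "b k < b (Suc k)" for k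
    using pick_b[of _ k] by (meson ex_in_conv le_less_trans)
  then have b: "strict_mono b"
    by (rule strict_mono_Suc_iff[THEN iffD2, rule_format])
  define D where "D = (\<Union>k. pick (b k))"
  have "infinite D"
    unfolding infinite_nat_iff_unbounded_le
  proof
    fix k
    obtain s where "s \<in> pick (b k)"
      using \<open>pick (b k) \<noteq> {}\<close> by blast
    then show "\<exists>s\<ge>k. s \<in> D"
      using pick_b(1) strict_mono_imp_increasing[OF b, of k] by (auto simp: D_def intro: order_trans)
  qed
  define t where "t = enumerate D"
  have t: "strict_mono t" "range t = D"
    using \<open>infinite D\<close> by (simp_all add: t_def strict_mono_enumerate range_enumerate)
  define U where "U = {X - A, X - B}"
  have "openin (top_of_set X) (X - A)" "openin (top_of_set X) (X - B)"
    using AB(1,2) by (metis Diff_eq open_Compl openin_open_Int)+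
  then have "finite_open_cover X U"
    using AB(3) by (auto simp: finite_open_cover_def U_def)
  then have "seq_entropy_cover X T t U \<le> seq_entropy X T t"
    unfolding seq_entropy_def by (intro SUP_upper) simp
  also have "\<dots> = 0"
    using null t(1) by (simp add: null_sys_def)
  finally have "seq_entropy_cover X T t U \<le> 0" .
  define h where "h = (\<lambda>n. ereal (ln (real (cover_num X (join_cover X T t U n))) / real n))"
  have "\<exists>n\<ge>k. ereal (ln 2 / 2) \<le> h n" for k
  proof -
    \<comment> \<open>The averages are examined exactly at the end of block \<open>k\<close>:
      \<open>E\<close> consists of the first \<open>n\<close> times of the sequence.\<close>
    define E where "E = D \<inter> {..<b (Suc k)}"
    define n where "n = card E"
    have "finite E"
      by (simp add: E_def)
    have "pick (b k) \<subseteq> E"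
      using pick_b by (auto simp: E_def D_def)
    have "E \<subseteq> t ` {..<n}"
    proof
      fix s assume "s \<in> E"
      then obtain i where i: "s = t i"
        using t(2) by (auto simp: E_def)
      have "t ` {..i} \<subseteq> E"
      proof
        fix r assume "r \<in> t ` {..i}"
        then have "r \<in> D" "r \<le> s"
          using t(2) i strict_mono_less_eq[OF t(1)] by auto
        then show "r \<in> E"
          using \<open>s \<in> E\<close> by (simp add: E_def)
      qed
      then have "card (t ` {..i}) \<le> n"
        unfolding n_def using \<open>finite E\<close> by (rule card_mono[rotated])
      then have "i < n"
        using strict_mono_imp_inj_on[OF t(1)] by (simp add: card_image)
      then show "s \<in> t ` {..<n}"
        using i by blast
    qed
    \<comment> \<open>At most \<open>b k\<close> times precede a block of size
      \<open>Suc (b k)\<close>, so the block makes up at least half of \<open>E\<close>. Hence the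
      constant \<open>ln 2 / 2\<close>.\<close>
    have "E \<subseteq> {..<b k} \<union> pick (b k)"
    proof
      fix s assume "s \<in> E"
      then obtain j where j: "s \<in> pick (b j)" "s < b (Suc k)"
        by (auto simp: E_def D_def)
      then have "b j < b (Suc k)"
        using pick_b(1) by (meson le_less_trans)
      then have "j \<le> k"
        using b by (simp add: strict_mono_less less_Suc_eq_le)
      then consider "j = k" | "Suc j \<le> k"
        by linarith
      then show "s \<in> {..<b k} \<union> pick (b k)"
      proof cases
        case 2
        then have "b (Suc j) \<le> b k"
          using b by (simp add: strict_mono_less_eq)
        then show ?thesis
          using pick_b(2)[OF j(1)] by simp
      qed (use j in auto)
    qed
    then have "n \<le> card ({..<b k} \<union> pick (b k))"
      unfolding n_def using pick(1) by (intro card_mono) auto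
    also have "\<dots> \<le> b k + Suc (b k)"
      using card_Un_le[of "{..<b k}" "pick (b k)"] pick(2) by simp
    finally have upper: "n \<le> 2 * card (pick (b k))"
      using pick(2) by simp
    have lower: "Suc (b k) \<le> n"
      using card_mono[OF \<open>finite E\<close> \<open>pick (b k) \<subseteq> E\<close>] pick(2) by (simp add: n_def)
    have "2 ^ card (pick (b k)) \<le> cover_num X (join_cover X T t U n)"
      unfolding U_def using \<open>pick (b k) \<subseteq> E\<close> \<open>E \<subseteq> t ` {..<n}\<close> pick(1,4)
      by (intro independent_times_cover_num X AB) auto
    then have "2 ^ card (pick (b k)) \<le> real (cover_num X (join_cover X T t U n))"
      by (metis of_nat_le_iff of_nat_numeral of_nat_power)
    then have "ln (2 ^ card (pick (b k))) \<le> ln (real (cover_num X (join_cover X T t U n)))"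
      by (intro ln_mono) auto
    moreover have "real n / 2 * ln 2 \<le> real (card (pick (b k))) * ln 2"
      using upper by (intro mult_right_mono) auto
    ultimately have "real n * (ln 2 / 2) \<le> ln (real (cover_num X (join_cover X T t U n)))"
      by (simp only: ln_realpow zero_less_numeral)
    then have "ereal (ln 2 / 2) \<le> h n"
      using lower by (simp add: h_def field_simps)
    moreover have "k \<le> n"
      using lower strict_mono_imp_increasing[OF b, of k] by simp
    ultimately show ?thesis
      by blast
  qed
  then have "ereal (ln 2 / 2) \<le> limsup h"
    unfolding limsup_INF_SUP by (intro INF_greatest) (meson SUP_upper2 atLeast_iff)
  also have "\<dots> \<le> 0"
    using \<open>seq_entropy_cover X T t U \<le> 0\<close> by (simp add: seq_entropy_cover_def h_def)
  finally show False
    by (simp add: zero_ereal_def)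
qed

section \<open>Contradiction between nullness and independence\<close>

theorem mainTheorem4:
  fixes X :: "'a::metric_space set" and T :: "'a \<Rightarrow> 'a"
  assumes "dyn_system X T" and "distal X T" and "null_sys X T"
  shows "equicontinuous_sys X T"
proof (rule ccontr)
  assume "\<not> equicontinuous_sys X T"
  then obtain x0 z0 where x0: "x0 \<in> X" "z0 \<in> X" "x0 \<noteq> z0"
    and recurrence: "\<And>F d. finite F \<Longrightarrow> F \<subseteq> X \<Longrightarrow> d > 0 \<Longrightarrow>
      \<exists>n. \<exists>x\<in>X. dist x x0 < d \<and> dist ((T ^^ n) x) z0 < d \<and> (\<forall>a\<in>F. dist ((T ^^ n) a) a < d)"
    by (rule distal_sensitive_recurrence[OF assms(1,2)]) blast
  \<comment> \<open>A third of the distance keeps even the closed balls disjoint. Recurrence needs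
    open neighbourhoods, whereas the entropy bound needs closed sets with open complements.\<close>
  define r where "r = dist x0 z0 / 3"
  have r: "r > 0"
    using x0(3) by (simp add: r_def)
  have "dist x0 z0 \<le> 2 * r" if "dist x0 w \<le> r" "dist z0 w \<le> r" for w
    using that dist_triangle2[of x0 z0 w] by linarith
  then have disj: "cball x0 r \<inter> cball z0 r = {}"
    using r by (force simp: r_def)
  then have "ball x0 r \<inter> ball z0 r = {}"
    using ball_subset_cball by blast
  then have "\<exists>G. finite G \<and> card G = m \<and> independent_times X T (ball x0 r) (ball z0 r) G" for m
    using r
    by (intro independent_times_of_recurrence[OF assms(1) x0(1) _ _ x0(2) _ _ recurrence]) auto
  then have "\<exists>G. finite G \<and> card G = m \<and> independent_times X T (cball x0 r) (cball z0 r) G" for m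
    using independent_times_mono[OF _ ball_subset_cball ball_subset_cball order_refl] by metis
  then have "\<not> null_sys X T"
    by (intro independent_times_not_null[OF assms(1) _ _ disj]) auto
  with assms(3) show False
    by contradiction
qed

end
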